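(* Let $k_\mathcal{G}=k_\mathcal{H}=1$ and $d=n_\mathcal{G}+n_\mathcal{H}-1$. Suppose real numbers $c_{w,i}$, $1\le w\le\lceil d/2\rceil$, $0\le i\le\lceil d/2\rceil$, satisfy $c_{w,0}=-c_{w,1}$ for all $1\le w\le\lceil d/2\rceil$ and, for all $2\le k\le d$, $$(-1)^k\Big(\sum_{w=1}^{\lceil d/2\rceil}c_{w,1}^2+1\Big)=\sum_{i=\lceil k/2\rceil}^{\min\{k,\lceil d/2\rceil\}}\sum_{w=1}^{\lceil d/2\rceil}c_{w,i}^2\binom{i}{k-i}\binom{k}{i}+2\sum_{j=\lceil (k+1)/2\rceil}^{\min\{k,\lceil d/2\rceil\}}\sum_{i=k-j}^{j-1}\sum_{w=1}^{\lceil d/2\rceil}c_{w,i}c_{w,j}\binom{i}{k-j}\binom{k}{i}.$$ Then for any choice of $(g,h)\in V(\mathcal{G}\square\mathcal{H})$, the polynomials $s_{g^*h^*}=x_{g^*h^*}$ for all $(g^*,h^* )\in V(\mathcal{G}\square\mathcal{H})\setminus T_{gh}$ and $s_w=\sum_{i=0}^{\lceil d/2\rceil}c_{w,i}\rho^i_{gh}$ for $1\le w\le\lceil d/2\rceil$ form a $\lceil d/2\rceil$-SOS-certificate of $f_{\text{viz}}$, i.e. $f_{\text{viz}}\equiv\sum_{(g^*,h^* )\notin T_{gh}}s_{g^*h^*}^2+\sum_{w}s_w^2\pmod{I_{\text{viz}}}$; therefore Vizing's conjecture holds on the graph classes $\mathcal{G}$ and $\mathcal{H}$.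
   Context: Let $\mathbb{K}\subseteq\mathbb{R}$ be a field containing the numbers used. Let $n_\mathcal{G},n_\mathcal{H}$ be positive integers, $V(\mathcal{G})=\{g_1,\dots,g_{n_\mathcal{G}}\}$, $V(\mathcal{H})=\{h_1,\dots,h_{n_\mathcal{H}}\}$, $V(\mathcal{G}\square\mathcal{H})=V(\mathcal{G})\times V(\mathcal{H})$; $\mathcal{G}$ ($\mathcal{H}$) is the class of graphs on $V(\mathcal{G})$ ($V(\mathcal{H})$) with minimum dominating set $\{g_1\}$ ($\{h_1\}$). Introduce an edge variable $e_{gg'}=e_{g'g}$ for every unordered pair of distinct $g,g'\in V(\mathcal{G})$, an edge variable $e_{hh'}=e_{h'h}$ for every unordered pair of distinct $h,h'\in V(\mathcal{H})$, and a vertex variable $x_{gh}$ for every $(g,h)\in V(\mathcal{G}\square\mathcal{H})$; let $P$ be the polynomial ring over $\mathbb{K}$ in all these variables. For $k_\mathcal{G}=k_\mathcal{H}=1$ the Vizing ideal $I_{\text{viz}}\subseteq P$ is generated by: $e_{gg'}(e_{gg'}-1)$ for all distinct $g,g'\in V(\mathcal{G})$; $1-e_{gg_1}$ for all $g\ne g_1$; $e_{hh'}(e_{hh'}-1)$ for all distinct $h,h'\in V(\mathcal{H})$; $1-e_{hh_1}$ for all $h\neq h_1$; and, for all $(g,h)$, $x_{gh}(x_{gh}-1)$ and $(1-x_{gh})\prod_{g'\ne g}(1-e_{gg'}x_{g'h})\prod_{h'\neq h}(1-e_{hh'}x_{gh'})$. The Vizing polynomial is $f_{\text{viz}}=\big(\sum_{(g,h)}x_{gh}\big)-k_\mathcal{G}k_\mathcal{H}$.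 A polynomial $f$ is $\ell$-SOS modulo $I$ if $f-\sum_i s_i^2\in I$ for some polynomials $s_i$ of degree at most $\ell$ (an SOS-certificate of degree $\ell$); by prior work, $f_{\text{viz}}$ being $\ell$-SOS modulo $I_{\text{viz}}$ implies $\gamma(G\square H)\ge\gamma(G)\gamma(H)$ for all $G\in\mathcal{G}$, $H\in\mathcal{H}$. For $(g,h)$ let $T_{gh}=\{(g',h') : g'=g\text{ or }h'=h\}$ and, for $0\le i\le d$, $\rho^i_{gh}=\sum_{S\subseteq T_{gh},\,|S|=i}\prod_{(g',h')\in S}x_{g'h'}$ (so $\rho^0_{gh}=1$). *)

theory Defs
  imports Complex_Main "HOL-Library.Poly_Mapping"
begin

(* Multivariate polynomials with real coefficients and variables in 'v:
   finitely supported maps from monomials to coefficients. *)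
type_synonym 'v rpoly = "('v \<Rightarrow>\<^sub>0 nat) \<Rightarrow>\<^sub>0 real"

definition mvar :: "'v \<Rightarrow> 'v rpoly" where
  "mvar v = Poly_Mapping.single (Poly_Mapping.single v 1) 1"

definition mconst :: "real \<Rightarrow> 'v rpoly" where
  "mconst c = Poly_Mapping.single 0 c"

definition monom_degree :: "('v \<Rightarrow>\<^sub>0 nat) \<Rightarrow> nat" where
  "monom_degree m = (\<Sum>v\<in>Poly_Mapping.keys m. Poly_Mapping.lookup m v)"

(* Total degree; the zero polynomial gets degree 0. *)
definition total_degree :: "'v rpoly \<Rightarrow> nat" where
  "total_degree p = Max (insert 0 (monom_degree ` Poly_Mapping.keys p))"

definition real_subfield :: "real set \<Rightarrow> bool" where
  "real_subfield K \<longleftrightarrow> 0 \<in> K \<and> 1 \<in> K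
     \<and> (\<forall>a\<in>K. \<forall>b\<in>K. a + b \<in> K \<and> a * b \<in> K)
     \<and> (\<forall>a\<in>K. - a \<in> K \<and> inverse a \<in> K)"

(* The polynomial ring K[X], as a subring of the type of all real polynomials. *)
definition poly_ring :: "real set \<Rightarrow> 'v set \<Rightarrow> 'v rpoly set" where
  "poly_ring K X = {p. (\<forall>m. Poly_Mapping.lookup p m \<in> K)
                     \<and> (\<forall>m\<in>Poly_Mapping.keys p. Poly_Mapping.keys m \<subseteq> X)}"

(* The ideal of the ring R generated by B: the multipliers range over R only. *)
definition ideal_gen :: "'v rpoly set \<Rightarrow> 'v rpoly set \<Rightarrow> 'v rpoly set" where
  "ideal_gen R B = {\<Sum>b\<in>T. q b * b | T q. finite T \<and> T \<subseteq> B \<and> (\<forall>b\<in>T. q b \<in> R)}"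

definition sos_certificate ::
  "nat \<Rightarrow> 'v rpoly set \<Rightarrow> 'v rpoly set \<Rightarrow> 'v rpoly \<Rightarrow> 'i set \<Rightarrow> ('i \<Rightarrow> 'v rpoly) \<Rightarrow> bool" where
  "sos_certificate l R I f J s \<longleftrightarrow> finite J
     \<and> (\<forall>j\<in>J. s j \<in> R \<and> total_degree (s j) \<le> l)
     \<and> f - (\<Sum>j\<in>J. (s j)\<^sup>2) \<in> I"


(* Edge variables are indexed by two-element vertex sets, so that the variables of gg' and g'g
   coincide. *)
datatype ('a, 'b) viz_var = EdgeG "'a set" | EdgeH "'b set" | Vert 'a 'b

definition viz_vars :: "'a set \<Rightarrow> 'b set \<Rightarrow> ('a, 'b) viz_var set" where
  "viz_vars VG VH =
     {EdgeG {g, g'} | g g'. g \<in> VG \<and> g' \<in> VG \<and> g \<noteq> g'}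
   \<union> {EdgeH {h, h'} | h h'. h \<in> VH \<and> h' \<in> VH \<and> h \<noteq> h'}
   \<union> {Vert g h | g h. g \<in> VG \<and> h \<in> VH}"

definition eG :: "'a \<Rightarrow> 'a \<Rightarrow> ('a, 'b) viz_var rpoly" where
  "eG g g' = mvar (EdgeG {g, g'})"

definition eH :: "'b \<Rightarrow> 'b \<Rightarrow> ('a, 'b) viz_var rpoly" where
  "eH h h' = mvar (EdgeH {h, h'})"

definition xv :: "'a \<Rightarrow> 'b \<Rightarrow> ('a, 'b) viz_var rpoly" where
  "xv g h = mvar (Vert g h)"

definition viz_gens :: "'a set \<Rightarrow> 'b set \<Rightarrow> 'a \<Rightarrow> 'b \<Rightarrow> ('a, 'b) viz_var rpoly set" where
  "viz_gens VG VH g1 h1 =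
     {eG g g' * (eG g g' - 1) | g g'. g \<in> VG \<and> g' \<in> VG \<and> g \<noteq> g'}
   \<union> {1 - eG g g1 | g. g \<in> VG \<and> g \<noteq> g1}
   \<union> {eH h h' * (eH h h' - 1) | h h'. h \<in> VH \<and> h' \<in> VH \<and> h \<noteq> h'}
   \<union> {1 - eH h h1 | h. h \<in> VH \<and> h \<noteq> h1}
   \<union> {xv g h * (xv g h - 1) | g h. g \<in> VG \<and> h \<in> VH}
   \<union> {(1 - xv g h) * (\<Prod>g'\<in>VG - {g}. 1 - eG g g' * xv g' h)
                   * (\<Prod>h'\<in>VH - {h}. 1 - eH h h' * xv g h') | g h. g \<in> VG \<and> h \<in> VH}"

definition viz_ring :: "real set \<Rightarrow> 'a set \<Rightarrow> 'b set \<Rightarrow> ('a, 'b) viz_var rpoly set" where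
  "viz_ring K VG VH = poly_ring K (viz_vars VG VH)"

definition viz_ideal ::
  "real set \<Rightarrow> 'a set \<Rightarrow> 'b set \<Rightarrow> 'a \<Rightarrow> 'b \<Rightarrow> ('a, 'b) viz_var rpoly set" where
  "viz_ideal K VG VH g1 h1 = ideal_gen (viz_ring K VG VH) (viz_gens VG VH g1 h1)"

definition viz_poly :: "'a set \<Rightarrow> 'b set \<Rightarrow> nat \<Rightarrow> nat \<Rightarrow> ('a, 'b) viz_var rpoly" where
  "viz_poly VG VH kG kH = (\<Sum>(g, h)\<in>VG \<times> VH. xv g h) - of_nat (kG * kH)"

definition cross :: "'a set \<Rightarrow> 'b set \<Rightarrow> 'a \<Rightarrow> 'b \<Rightarrow> ('a \<times> 'b) set" where
  "cross VG VH g h = {(g', h') \<in> VG \<times> VH. g' = g \<or> h' = h}"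

definition rho :: "'a set \<Rightarrow> 'b set \<Rightarrow> 'a \<Rightarrow> 'b \<Rightarrow> nat \<Rightarrow> ('a, 'b) viz_var rpoly" where
  "rho VG VH g h i = (\<Sum>S | S \<subseteq> cross VG VH g h \<and> card S = i. \<Prod>(g', h')\<in>S. xv g' h')"

definition ceil_half :: "nat \<Rightarrow> nat" where
  "ceil_half n = nat \<lceil>real n / 2\<rceil>"


(* A graph on a vertex set V is given by its set E of edges, each a two-element subset of V. *)
definition simple_graph :: "'a set \<Rightarrow> 'a set set \<Rightarrow> bool" where
  "simple_graph V E \<longleftrightarrow> E \<subseteq> {{u, v} | u v. u \<in> V \<and> v \<in> V \<and> u \<noteq> v}"

definition dominating_set :: "'a set \<Rightarrow> 'a set set \<Rightarrow> 'a set \<Rightarrow> bool" where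
  "dominating_set V E D \<longleftrightarrow> D \<subseteq> V \<and> (\<forall>v\<in>V. v \<in> D \<or> (\<exists>u\<in>D. {u, v} \<in> E))"

definition minimum_dominating_set :: "'a set \<Rightarrow> 'a set set \<Rightarrow> 'a set \<Rightarrow> bool" where
  "minimum_dominating_set V E D \<longleftrightarrow> dominating_set V E D
     \<and> (\<forall>D'. dominating_set V E D' \<longrightarrow> card D \<le> card D')"

definition domination_number :: "'a set \<Rightarrow> 'a set set \<Rightarrow> nat" where
  "domination_number V E = Min (card ` {D. dominating_set V E D})"

definition box_edges ::
  "'a set \<Rightarrow> 'a set set \<Rightarrow> 'b set \<Rightarrow> 'b set set \<Rightarrow> ('a \<times> 'b) set set" where
  "box_edges VG EG VH EH =
     {{(g, h), (g', h')} | g h g' h'. g \<in> VG \<and> g' \<in> VG \<and> h \<in> VH \<and> h' \<in> VH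
        \<and> (g = g' \<and> {h, h'} \<in> EH \<or> h = h' \<and> {g, g'} \<in> EG)}"

definition graph_class :: "'a set \<Rightarrow> 'a \<Rightarrow> 'a set set set" where
  "graph_class V v = {E. simple_graph V E \<and> minimum_dominating_set V E {v}}"

definition vizing_holds_on ::
  "'a set \<Rightarrow> 'a set set set \<Rightarrow> 'b set \<Rightarrow> 'b set set set \<Rightarrow> bool" where
  "vizing_holds_on VG \<G> VH \<H> \<longleftrightarrow> (\<forall>EG\<in>\<G>. \<forall>EH\<in>\<H>.
     domination_number VG EG * domination_number VH EH
       \<le> domination_number (VG \<times> VH) (box_edges VG EG VH EH))"

end

theory Submission imports Defs begin

text \<open>
  Modulo the Vizing ideal the vertex variables are idempotent, so the product of the squarefree
  monomials of \<open>A\<close> and \<open>B\<close> is the one of \<open>A \<union> B\<close>, and \<open>\<rho>\<^sup>i \<rho>\<^sup>j\<close> expands into the \<open>\<rho>\<^sup>k\<close> with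
  coefficients counting the pairs \<open>(A, B)\<close> of an \<open>i\<close>-set and a \<open>j\<close>-set whose union is a given
  \<open>k\<close>-set. With \<open>S = \<Sum>\<^sub>w c\<^sub>w\<^sub>,\<^sub>1\<^sup>2\<close>, the hypotheses say that the coefficient of \<open>\<rho>\<^sup>k\<close> in \<open>\<Sum>\<^sub>w s\<^sub>w\<^sup>2\<close>
  is \<open>(-1)\<^sup>k (S + 1)\<close>, corrected by \<open>-1\<close> at \<open>k = 0\<close> and by \<open>+1\<close> at \<open>k = 1\<close>.
  The alternating sum of the \<open>\<rho>\<^sup>k\<close> is the product of all \<open>1 - x\<close> over the cross, and it lies in the
  ideal: \<open>1 - x\<close> absorbs the factor \<open>1 - e x\<close>, so this product is congruent to its multiple by the
  domination generator at \<open>(g, h)\<close>. What remains of \<open>\<Sum>\<^sub>w s\<^sub>w\<^sup>2\<close> is \<open>\<rho>\<^sup>1 - 1\<close>.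
\<close>

section \<open>Ideals of subrings\<close>

text \<open>\<open>I\<close> is an ideal relative to \<open>R\<close>, not to the whole type: in the
  application the type holds all real polynomials, while multipliers come only from the polynomial
  ring over \<open>K\<close> in the given variables. Hence the membership side conditions in the
  congruence rules.\<close>

locale subring_ideal =
  fixes R I :: "'r::comm_ring_1 set"
  assumes one_R: "1 \<in> R"
    and minus_R: "a \<in> R \<Longrightarrow> - a \<in> R"
    and add_R: "a \<in> R \<Longrightarrow> b \<in> R \<Longrightarrow> a + b \<in> R"
    and mult_R: "a \<in> R \<Longrightarrow> b \<in> R \<Longrightarrow> a * b \<in> R"
    and zero_I: "0 \<in> I"
    and add_I: "a \<in> I \<Longrightarrow> b \<in> I \<Longrightarrow> a + b \<in> I"
    and mult_I: "a \<in> R \<Longrightarrow> b \<in> I \<Longrightarrow> a * b \<in> I"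
begin

definition eqv :: "'r \<Rightarrow> 'r \<Rightarrow> bool" (infix \<open>\<simeq>\<close> 50)
  where "a \<simeq> b \<longleftrightarrow> a - b \<in> I"

lemma zero_R: "0 \<in> R"
  using add_R[OF one_R minus_R[OF one_R]] by simp

lemma diff_R: "a \<in> R \<Longrightarrow> b \<in> R \<Longrightarrow> a - b \<in> R"
  using add_R[of a "- b"] minus_R[of b] by simp

lemma sum_R: "(\<And>i. i \<in> A \<Longrightarrow> f i \<in> R) \<Longrightarrow> sum f A \<in> R"
  by (induction A rule: infinite_finite_induct) (auto intro: zero_R add_R)

lemma prod_R: "(\<And>i. i \<in> A \<Longrightarrow> f i \<in> R) \<Longrightarrow> prod f A \<in> R"
  by (induction A rule: infinite_finite_induct) (auto intro: one_R mult_R)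

lemma minus_I: "a \<in> I \<Longrightarrow> - a \<in> I"
  using mult_I[OF minus_R[OF one_R], of a] by simp

lemma eqv_refl: "a \<simeq> a"
  by (simp add: eqv_def zero_I)

lemma eqv_sym: "a \<simeq> b \<Longrightarrow> b \<simeq> a"
  unfolding eqv_def using minus_I[of "a - b"] by simp

lemma eqv_trans [trans]: "a \<simeq> b \<Longrightarrow> b \<simeq> c \<Longrightarrow> a \<simeq> c"
  unfolding eqv_def using add_I[of "a - b" "b - c"] by simp

lemma eqv_add: "a \<simeq> a' \<Longrightarrow> b \<simeq> b' \<Longrightarrow> a + b \<simeq> a' + b'"
  unfolding eqv_def using add_I[of "a - a'" "b - b'"] by (simp add: algebra_simps)

text \<open>The difference splits as \<open>b * (a - a') + a' * (b - b')\<close>, so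
  \<open>b\<close> and \<open>a'\<close> are the multipliers whose membership in \<open>R\<close> is
  required.\<close>

lemma eqv_mult: "a \<simeq> a' \<Longrightarrow> b \<simeq> b' \<Longrightarrow> a' \<in> R \<Longrightarrow> b \<in> R \<Longrightarrow> a * b \<simeq> a' * b'"
  unfolding eqv_def
  using add_I[OF mult_I[of b "a - a'"] mult_I[of a' "b - b'"]] by (simp add: algebra_simps)

lemma eqv_sum: "(\<And>i. i \<in> A \<Longrightarrow> f i \<simeq> g i) \<Longrightarrow> sum f A \<simeq> sum g A"
  by (induction A rule: infinite_finite_induct) (auto intro: eqv_refl eqv_add)

lemma eqv_prod:
  "(\<And>i. i \<in> A \<Longrightarrow> f i \<simeq> g i) \<Longrightarrow> (\<And>i. i \<in> A \<Longrightarrow> f i \<in> R) \<Longrightarrow> (\<And>i. i \<in> A \<Longrightarrow> g i \<in> R)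
    \<Longrightarrow> prod f A \<simeq> prod g A"
  by (induction A rule: infinite_finite_induct) (auto intro!: eqv_refl eqv_mult prod_R)

end

section \<open>Elementary symmetric polynomials of idempotents\<close>

definition esym :: "('i \<Rightarrow> 'r::comm_ring_1) \<Rightarrow> 'i set \<Rightarrow> nat \<Rightarrow> 'r" where
  "esym x T i = (\<Sum>S | S \<subseteq> T \<and> card S = i. prod x S)"

text \<open>The guard is needed since truncated subtraction turns \<open>i choose (k - j)\<close> into 1 for \<open>j > k\<close>.\<close>

definition cover_count :: "nat \<Rightarrow> nat \<Rightarrow> nat \<Rightarrow> nat" where
  "cover_count k i j = (if j \<le> k then (i choose (k - j)) * (k choose i) else 0)"

text \<open>Choose \<open>A\<close> as any \<open>i\<close>-subset of \<open>S\<close>. Then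
  \<open>B\<close> must contain \<open>S - A\<close>, so it is determined by its complement
  \<open>S - B\<close>, an arbitrary subset of \<open>A\<close> of size
  \<open>card S - j\<close>.\<close>

lemma card_covering_pairs:
  assumes "finite S"
  shows "card {(A, B). A \<union> B = S \<and> card A = i \<and> card B = j} = cover_count (card S) i j"
proof (cases "j \<le> card S")
  case True
  let ?P = "{A. A \<subseteq> S \<and> card A = i}"
  let ?Q = "\<lambda>A. {B. A \<union> B = S \<and> card B = j}"
  have inner: "card (?Q A) = i choose (card S - j)" if A: "A \<in> ?P" for A
  proof -
    have "bij_betw ((-) S) (?Q A) {C. C \<subseteq> A \<and> card C = card S - j}"
    proof (rule bij_betw_byWitness[where f' = "(-) S"])
      show "(-) S ` ?Q A \<subseteq> {C. C \<subseteq> A \<and> card C = card S - j}"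
        using assms by (auto simp: card_Diff_subset finite_subset)
      have "card (S - C) = j" if "C \<subseteq> A" "card C = card S - j" for C
        using that A assms True by (subst card_Diff_subset) (auto intro: finite_subset)
      then show "(-) S ` {C. C \<subseteq> A \<and> card C = card S - j} \<subseteq> ?Q A"
        using A by auto
    qed (use A in auto)
    then have "card (?Q A) = card {C. C \<subseteq> A \<and> card C = card S - j}"
      by (rule bij_betw_same_card)
    also have "\<dots> = i choose (card S - j)"
      using A assms n_subsets[of A "card S - j"] by (auto intro: finite_subset)
    finally show ?thesis .
  qed
  have "{(A, B). A \<union> B = S \<and> card A = i \<and> card B = j} = Sigma ?P ?Q"
    by auto
  moreover have "finite (?Q A)" for A
    by (rule finite_subset[of _ "Pow S"]) (use assms in auto)
  ultimately have "card {(A, B). A \<union> B = S \<and> card A = i \<and> card B = j} = (\<Sum>A\<in>?P. card (?Q A))"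
    using assms by simp
  also have "\<dots> = card ?P * (i choose (card S - j))"
    using inner by simp
  finally show ?thesis
    using True n_subsets[OF assms, of i] by (simp add: cover_count_def)
next
  case False
  then have "{(A, B). A \<union> B = S \<and> card A = i \<and> card B = j} = {}"
    using assms card_mono[OF assms] by blast
  then show ?thesis
    using False by (simp only: cover_count_def card.empty if_False)
qed

text \<open>The binomial formula is not visibly symmetric, but the set of pairs that it counts is
  mapped to its mirror image by taking the converse relation.\<close>

lemma cover_count_commute: "cover_count k i j = cover_count k j i"
proof -
  let ?C = "\<lambda>i j. {(A, B). A \<union> B = {..<k} \<and> card A = i \<and> card B = j}"
  have "card (?C i j) = card ((?C i j)\<inverse>)"
    by (rule card_inverse[symmetric])
  also have "(?C i j)\<inverse> = ?C j i"
    by (simp add: converse_unfold Un_commute conj_commute)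
  finally show ?thesis
    by (simp only: card_covering_pairs[OF finite_lessThan] card_lessThan)
qed

text \<open>Grouping the subsets by size turns a sum over subsets into a combination of elementary
  symmetric polynomials. This serves both the expansion of \<open>\<Prod>t\<in>T. 1 - x t\<close>
  and the multiplication rule for \<open>esym\<close>.\<close>

lemma sum_Pow_by_card:
  assumes "finite T"
  shows "(\<Sum>S\<in>Pow T. f (card S) * prod x S) = (\<Sum>k\<le>card T. f k * esym x T k)"
proof -
  have "(\<Sum>k\<le>card T. f k * esym x T k)
      = (\<Sum>k\<le>card T. \<Sum>S | S \<in> Pow T \<and> card S = k. f (card S) * prod x S)"
    by (simp add: esym_def sum_distrib_left)
  also have "\<dots> = (\<Sum>S\<in>Pow T. f (card S) * prod x S)"
    by (rule sum.group) (use assms in \<open>auto intro: card_mono\<close>)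
  finally show ?thesis ..
qed

lemma prod_one_minus_eq_esym:
  assumes "finite T"
  shows "(\<Prod>t\<in>T. 1 - x t) = (\<Sum>k\<le>card T. (- 1) ^ k * esym x T k)"
  using assms by (simp add: prod_diff_conv_sum flip: sum_Pow_by_card)

section \<open>Products and squares of elementary symmetric polynomials modulo the ideal\<close>

context subring_ideal
begin

text \<open>The variables of \<open>A \<inter> B\<close> occur twice in the product and those of the
  symmetric difference once; idempotence collapses the repeated ones.\<close>

lemma prod_mult_prod_eqv_prod_Un:
  assumes "finite A" "finite B"
    and "\<And>t. t \<in> A \<union> B \<Longrightarrow> x t \<in> R" "\<And>t. t \<in> A \<union> B \<Longrightarrow> x t * x t \<simeq> x t"
  shows "prod x A * prod x B \<simeq> prod x (A \<union> B)"
proof -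
  let ?D = "(A - B) \<union> (B - A)"
  have split: "prod x (A \<union> B) = prod x ?D * prod x (A \<inter> B)"
    by (subst prod.union_disjoint[symmetric]) (use assms in \<open>auto intro!: prod.cong\<close>)
  have "prod x A * prod x B = prod x (A \<union> B) * prod x (A \<inter> B)"
    by (rule prod.union_inter[symmetric]) (use assms in auto)
  also have "\<dots> = prod x ?D * (\<Prod>t\<in>A \<inter> B. x t * x t)"
    by (simp add: split prod.distrib mult.assoc)
  also have "\<dots> \<simeq> prod x ?D * prod x (A \<inter> B)"
    by (intro eqv_mult eqv_prod eqv_refl prod_R mult_R) (use assms in auto)
  finally show ?thesis
    by (simp add: split)
qed

lemma esym_R: "(\<And>t. t \<in> T \<Longrightarrow> x t \<in> R) \<Longrightarrow> esym x T i \<in> R"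
  unfolding esym_def by (intro sum_R prod_R) auto

text \<open>Multiplying out gives one term for each pair \<open>(A, B)\<close>, congruent to the
  monomial of \<open>A \<union> B\<close>. The pairs are then grouped by their union.\<close>

lemma esym_mult_eqv:
  assumes fin: "finite T"
    and "\<And>t. t \<in> T \<Longrightarrow> x t \<in> R" "\<And>t. t \<in> T \<Longrightarrow> x t * x t \<simeq> x t"
  shows "esym x T i * esym x T j \<simeq> (\<Sum>k\<le>card T. of_nat (cover_count k i j) * esym x T k)"
proof -
  let ?P = "\<lambda>i. {S. S \<subseteq> T \<and> card S = i}"
  have finP: "finite (?P i)" for i
    using fin by simp
  have "esym x T i * esym x T j = (\<Sum>(A, B)\<in>?P i \<times> ?P j. prod x A * prod x B)"
    by (simp add: esym_def sum_product sum.cartesian_product)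
  also have "\<dots> \<simeq> (\<Sum>(A, B)\<in>?P i \<times> ?P j. prod x (A \<union> B))"
    by (rule eqv_sum)
      (use assms in \<open>auto intro!: prod_mult_prod_eqv_prod_Un intro: finite_subset\<close>)
  also have "(\<Sum>(A, B)\<in>?P i \<times> ?P j. prod x (A \<union> B))
      = (\<Sum>S\<in>Pow T. \<Sum>p | p \<in> ?P i \<times> ?P j \<and> (\<lambda>(A, B). A \<union> B) p = S.
          (\<lambda>(A, B). prod x (A \<union> B)) p)"
    by (rule sum.group[symmetric]) (use fin finP in auto)
  also have "\<dots> = (\<Sum>S\<in>Pow T. of_nat (cover_count (card S) i j) * prod x S)"
  proof (rule sum.cong[OF refl])
    fix S assume S: "S \<in> Pow T"
    \<comment> \<open>Since \<open>S \<subseteq> T\<close>, the inclusions of \<open>A\<close> and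
      \<open>B\<close> in \<open>T\<close> follow from \<open>A \<union> B = S\<close>, so the fibre
      over \<open>S\<close> is the set counted by \<open>card_covering_pairs\<close>.\<close>
    have "{p. p \<in> ?P i \<times> ?P j \<and> (\<lambda>(A, B). A \<union> B) p = S}
        = {(A, B). A \<union> B = S \<and> card A = i \<and> card B = j}"
      using S by auto
    moreover have "(\<Sum>p\<in>{(A, B). A \<union> B = S \<and> card A = i \<and> card B = j}.
        (\<lambda>(A, B). prod x (A \<union> B)) p)
        = (\<Sum>p\<in>{(A, B). A \<union> B = S \<and> card A = i \<and> card B = j}. prod x S)"
      by (rule sum.cong) auto
    moreover have "finite S"
      using S fin by (auto intro: finite_subset)
    ultimately show "(\<Sum>p | p \<in> ?P i \<times> ?P j \<and> (\<lambda>(A, B). A \<union> B) p = S.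
          (\<lambda>(A, B). prod x (A \<union> B)) p) = of_nat (cover_count (card S) i j) * prod x S"
      by (simp add: card_covering_pairs)
  qed
  also have "\<dots> = (\<Sum>k\<le>card T. of_nat (cover_count k i j) * esym x T k)"
    by (rule sum_Pow_by_card[OF fin])
  finally show ?thesis .
qed

lemma sum_squares_esym_eqv:
  assumes fin: "finite T"
    and x: "\<And>t. t \<in> T \<Longrightarrow> x t \<in> R" "\<And>t. t \<in> T \<Longrightarrow> x t * x t \<simeq> x t"
    and a: "\<And>w i. w \<in> W \<Longrightarrow> i \<in> M \<Longrightarrow> a w i \<in> R"
  shows "(\<Sum>w\<in>W. (\<Sum>i\<in>M. a w i * esym x T i)\<^sup>2)
    \<simeq> (\<Sum>k\<le>card T. (\<Sum>w\<in>W. \<Sum>i\<in>M. \<Sum>j\<in>M. a w i * a w j * of_nat (cover_count k i j)) * esym x T k)"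
proof -
  let ?e = "esym x T"
  have "(\<Sum>w\<in>W. (\<Sum>i\<in>M. a w i * ?e i)\<^sup>2)
      = (\<Sum>w\<in>W. \<Sum>i\<in>M. \<Sum>j\<in>M. a w i * a w j * (?e i * ?e j))"
    by (simp add: power2_eq_square sum_product mult_ac)
  also have "\<dots> \<simeq> (\<Sum>w\<in>W. \<Sum>i\<in>M. \<Sum>j\<in>M. a w i * a w j *
      (\<Sum>k\<le>card T. of_nat (cover_count k i j) * ?e k))"
    by (intro eqv_sum eqv_mult eqv_refl esym_mult_eqv mult_R esym_R a x fin)
  also have "\<dots> = (\<Sum>w\<in>W. \<Sum>i\<in>M. \<Sum>j\<in>M. \<Sum>k\<le>card T.
      a w i * a w j * of_nat (cover_count k i j) * ?e k)"
    by (simp add: sum_distrib_left mult_ac)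
  \<comment> \<open>The sum over \<open>k\<close> moves outward past \<open>j\<close>,
    \<open>i\<close> and \<open>w\<close> in turn, so that the coefficient of each
    \<open>?e k\<close> can be collected.\<close>
  also have "\<dots> = (\<Sum>w\<in>W. \<Sum>i\<in>M. \<Sum>k\<le>card T. \<Sum>j\<in>M.
      a w i * a w j * of_nat (cover_count k i j) * ?e k)"
    by (intro sum.cong[OF refl] sum.swap)
  also have "\<dots> = (\<Sum>w\<in>W. \<Sum>k\<le>card T. \<Sum>i\<in>M. \<Sum>j\<in>M.
      a w i * a w j * of_nat (cover_count k i j) * ?e k)"
    by (intro sum.cong[OF refl] sum.swap)
  also have "\<dots> = (\<Sum>k\<le>card T. \<Sum>w\<in>W. \<Sum>i\<in>M. \<Sum>j\<in>M.
      a w i * a w j * of_nat (cover_count k i j) * ?e k)"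
    by (rule sum.swap)
  finally show ?thesis
    by (simp add: sum_distrib_right)
qed

end

section \<open>The coefficient equations\<close>

text \<open>Passing from \<open>m\<close> to \<open>Suc m\<close> adds a row and a column, equal by
  symmetry, and one corner. The off-diagonal part is indexed by the larger index first, as in the
  coefficient equations.\<close>

lemma sum_symmetric_square:
  fixes f :: "nat \<Rightarrow> nat \<Rightarrow> real"
  assumes "\<And>i j. f i j = f j i"
  shows "(\<Sum>i=0..m. \<Sum>j=0..m. f i j) = (\<Sum>i=0..m. f i i) + 2 * (\<Sum>j=0..m. \<Sum>i<j. f i j)"
proof (induction m)
  case (Suc m)
  have "(\<Sum>i=0..Suc m. \<Sum>j=0..Suc m. f i j)
      = (\<Sum>i=0..m. \<Sum>j=0..m. f i j) + (\<Sum>i=0..m. f i (Suc m)) + (\<Sum>j=0..m. f (Suc m) j)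
        + f (Suc m) (Suc m)"
    by (simp add: sum.distrib)
  also have "(\<Sum>j=0..m. f (Suc m) j) = (\<Sum>i=0..m. f i (Suc m))"
    using assms by (intro sum.cong) auto
  also have "(\<Sum>i=0..m. f i (Suc m)) = (\<Sum>i<Suc m. f i (Suc m))"
    by (simp add: lessThan_Suc_atMost atLeast0AtMost)
  finally show ?case
    using Suc by simp
qed simp

lemma ceil_half_eq: "ceil_half n = (n + 1) div 2"
  unfolding ceil_half_def by linarith

text \<open>These are the size constraints on two sets whose union has \<open>k\<close> elements.
  They cut the full double sum down to the index ranges of the coefficient equations.\<close>

lemma cover_count_pos_imp: "0 < cover_count k i j \<Longrightarrow> i \<le> k \<and> j \<le> k \<and> k \<le> i + j"
  by (auto simp: cover_count_def zero_less_binomial_iff split: if_splits)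

text \<open>Symmetry splits the double sum into its diagonal and twice its strict upper triangle;
  removing the vanishing counts leaves the stated ranges.\<close>

lemma sum_cover_count_eq:
  fixes c :: "nat \<Rightarrow> real"
  assumes "0 < k"
  shows "(\<Sum>i=0..m. \<Sum>j=0..m. c i * c j * real (cover_count k i j))
    = (\<Sum>i=ceil_half k..min k m. (c i)\<^sup>2 * real (i choose (k - i)) * real (k choose i))
    + 2 * (\<Sum>j=ceil_half (k + 1)..min k m. \<Sum>i=k - j..j - 1.
        c i * c j * real (i choose (k - j)) * real (k choose i))"
proof -
  let ?f = "\<lambda>i j. c i * c j * real (cover_count k i j)"
  have sym: "?f i j = ?f j i" for i j
    by (simp add: cover_count_commute[of k i j] mult.commute[of "c i"])
  have "(\<Sum>i=0..m. ?f i i) = (\<Sum>i=ceil_half k..min k m. ?f i i)"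
    by (rule sum.mono_neutral_right) (auto simp: ceil_half_eq dest: cover_count_pos_imp)
  also have "\<dots> = (\<Sum>i=ceil_half k..min k m.
      (c i)\<^sup>2 * real (i choose (k - i)) * real (k choose i))"
    by (rule sum.cong) (auto simp: cover_count_def power2_eq_square)
  finally have diag: "(\<Sum>i=0..m. ?f i i) = \<dots>" .
  \<comment> \<open>A nonzero count forces \<open>k \<le> i + j\<close>, whence the lower bound
    \<open>k - j\<close>. The condition \<open>0 < j\<close> lets \<open>i \<le> j - 1\<close> be
    read as \<open>i < j\<close> despite truncated subtraction.\<close>
  have row: "(\<Sum>i<j. ?f i j) = (\<Sum>i=k - j..j - 1. ?f i j)" if "0 < j" for j
  proof (rule sum.mono_neutral_right)
    have "cover_count k i j = 0" if "i < j" "i \<notin> {k - j..j - 1}" for i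
    proof (rule ccontr)
      assume "cover_count k i j \<noteq> 0"
      with cover_count_pos_imp[of k i j] that show False
        by auto
    qed
    then show "\<forall>i\<in>{..<j} - {k - j..j - 1}. ?f i j = 0"
      by simp
  qed (use that in auto)
  have "(\<Sum>j=0..m. \<Sum>i<j. ?f i j) = (\<Sum>j=ceil_half (k + 1)..min k m. \<Sum>i<j. ?f i j)"
  proof (rule sum.mono_neutral_right)
    \<comment> \<open>For \<open>i < j\<close> a nonzero count gives
      \<open>k \<le> i + j < 2 * j\<close>, hence \<open>j\<close> is at least
      \<open>ceil_half (k + 1)\<close>.\<close>
    have "cover_count k i j = 0" if "j \<le> m" "i < j" "j \<notin> {ceil_half (k + 1)..min k m}" for i j
    proof (rule ccontr)
      assume "cover_count k i j \<noteq> 0"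
      with cover_count_pos_imp[of k i j] that show False
        by (auto simp: ceil_half_eq)
    qed
    then show "\<forall>j\<in>{0..m} - {ceil_half (k + 1)..min k m}. (\<Sum>i<j. ?f i j) = 0"
      by (intro ballI sum.neutral) auto
  qed auto
  also have "\<dots> = (\<Sum>j=ceil_half (k + 1)..min k m. \<Sum>i=k - j..j - 1.
        c i * c j * real (i choose (k - j)) * real (k choose i))"
  proof (rule sum.cong[OF refl])
    fix j assume "j \<in> {ceil_half (k + 1)..min k m}"
    then show "(\<Sum>i<j. ?f i j)
        = (\<Sum>i=k - j..j - 1. c i * c j * real (i choose (k - j)) * real (k choose i))"
      by (subst row) (auto simp: ceil_half_eq cover_count_def mult_ac)
  qed
  finally show ?thesis
    using sum_symmetric_square[of ?f m, OF sym] diag by simp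
qed

text \<open>Write \<open>S\<close> for the sum of the \<open>(c w 1)\<^sup>2\<close>. For
  \<open>k \<ge> 2\<close> this is the hypothesis. For \<open>k = 0\<close> only the pair of empty
  sets counts, giving \<open>S = (S + 1) - 1\<close>. For \<open>k = 1\<close> the diagonal gives
  \<open>S\<close> and the mixed terms \<open>- 2 * S\<close>, in total
  \<open>- S = - (S + 1) + 1\<close>.\<close>

lemma coefficient_eqs:
  fixes c :: "nat \<Rightarrow> nat \<Rightarrow> real"
  assumes "0 < m"
    and c0: "\<And>w. w \<in> W \<Longrightarrow> c w 0 = - c w 1"
    and eqs: "\<And>k. k \<in> {2..d} \<Longrightarrow>
      (- 1) ^ k * ((\<Sum>w\<in>W. (c w 1)\<^sup>2) + 1) =
        (\<Sum>i=ceil_half k..min k m. \<Sum>w\<in>W.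
           (c w i)\<^sup>2 * real (i choose (k - i)) * real (k choose i))
      + 2 * (\<Sum>j=ceil_half (k + 1)..min k m. \<Sum>i=k - j..j - 1. \<Sum>w\<in>W.
           c w i * c w j * real (i choose (k - j)) * real (k choose i))"
    and "k \<le> d"
  shows "(\<Sum>w\<in>W. \<Sum>i=0..m. \<Sum>j=0..m. c w i * c w j * real (cover_count k i j))
    = (- 1) ^ k * ((\<Sum>w\<in>W. (c w 1)\<^sup>2) + 1) + (if k = 0 then - 1 else if k = 1 then 1 else 0)"
proof (cases "k = 0")
  case True
  have "(\<Sum>i=0..m. \<Sum>j=0..m. c w i * c w j * real (cover_count 0 i j)) = (c w 0)\<^sup>2" for w
  proof -
    have "(\<Sum>i=0..m. \<Sum>j=0..m. c w i * c w j * real (cover_count 0 i j))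
        = (\<Sum>i=0..m. \<Sum>j=0..m. if j = 0 then if i = 0 then c w 0 * c w 0 else 0 else 0)"
      by (intro sum.cong refl) (auto simp: cover_count_def)
    then show ?thesis
      by (simp add: power2_eq_square)
  qed
  then show ?thesis
    using True c0 by simp
next
  case False
  have "(\<Sum>w\<in>W. \<Sum>i=0..m. \<Sum>j=0..m. c w i * c w j * real (cover_count k i j))
    = (\<Sum>w\<in>W. \<Sum>i=ceil_half k..min k m. (c w i)\<^sup>2 * real (i choose (k - i)) * real (k choose i))
    + 2 * (\<Sum>w\<in>W. \<Sum>j=ceil_half (k + 1)..min k m. \<Sum>i=k - j..j - 1.
        c w i * c w j * real (i choose (k - j)) * real (k choose i))" (is "?L = ?D + 2 * ?O")
    using False by (simp add: sum_cover_count_eq sum.distrib sum_distrib_left)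
  also have "?D = (\<Sum>i=ceil_half k..min k m. \<Sum>w\<in>W.
      (c w i)\<^sup>2 * real (i choose (k - i)) * real (k choose i))"
    by (rule sum.swap)
  also have "?O = (\<Sum>j=ceil_half (k + 1)..min k m. \<Sum>w\<in>W. \<Sum>i=k - j..j - 1.
        c w i * c w j * real (i choose (k - j)) * real (k choose i))"
    by (rule sum.swap)
  also have "\<dots> = (\<Sum>j=ceil_half (k + 1)..min k m. \<Sum>i=k - j..j - 1. \<Sum>w\<in>W.
        c w i * c w j * real (i choose (k - j)) * real (k choose i))"
    by (intro sum.cong[OF refl] sum.swap)
  finally have L: "?L = (\<Sum>i=ceil_half k..min k m. \<Sum>w\<in>W.
      (c w i)\<^sup>2 * real (i choose (k - i)) * real (k choose i))
      + 2 * (\<Sum>j=ceil_half (k + 1)..min k m. \<Sum>i=k - j..j - 1. \<Sum>w\<in>W.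
        c w i * c w j * real (i choose (k - j)) * real (k choose i))" .
  show ?thesis
  proof (cases "k = 1")
    case True
    \<comment> \<open>With this the diagonal sum keeps only \<open>i = 1\<close>, and the mixed sum
      only \<open>j = 1\<close>, \<open>i = 0\<close>.\<close>
    have "min 1 m = 1"
      using \<open>0 < m\<close> by simp
    moreover have "(\<Sum>w\<in>W. c w 0 * c w 1) = - (\<Sum>w\<in>W. (c w 1)\<^sup>2)"
      using c0 by (simp add: power2_eq_square sum_negf)
    ultimately show ?thesis
      using L by (simp add: True ceil_half_eq)
  next
    case False
    then show ?thesis
      using L eqs[of k] \<open>k \<noteq> 0\<close> \<open>k \<le> d\<close> by simp
  qed
qed

section \<open>Polynomial rings over subfields of the reals\<close>

lemma real_subfield_sum:
  assumes "real_subfield K" "\<And>i. i \<in> A \<Longrightarrow> f i \<in> K"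
  shows "sum f A \<in> K"
  using assms(2)
  by (induction A rule: infinite_finite_induct) (use assms(1) in \<open>auto simp: real_subfield_def\<close>)

text \<open>Coefficients of a product of polynomials are convolutions written with
  \<open>Sum_any\<close>, so closure of \<open>K\<close> is needed in this form.\<close>

lemma real_subfield_Sum_any:
  assumes "real_subfield K" "\<And>i. f i \<in> K"
  shows "Sum_any f \<in> K"
  unfolding Sum_any.expand_set using assms by (intro real_subfield_sum)

lemma poly_ring_mult:
  assumes K: "real_subfield K" and p: "p \<in> poly_ring K X" and q: "q \<in> poly_ring K X"
  shows "p * q \<in> poly_ring K X"
proof -
  have "Poly_Mapping.lookup (p * q) m \<in> K" for m
  proof -
    have "(Poly_Mapping.lookup q b when m = a + b) \<in> K" for a b
      using K q by (auto simp: when_def poly_ring_def real_subfield_def)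
    then have "Poly_Mapping.lookup p a * (\<Sum>b. (Poly_Mapping.lookup q b when m = a + b)) \<in> K" for a
      using K p real_subfield_Sum_any[OF K, of "\<lambda>b. (Poly_Mapping.lookup q b when m = a + b)"]
      by (simp add: poly_ring_def real_subfield_def)
    then show ?thesis
      unfolding lookup_mult by (intro real_subfield_Sum_any[OF K])
  qed
  moreover have "Poly_Mapping.keys m \<subseteq> X" if m: "m \<in> Poly_Mapping.keys (p * q)" for m
  proof -
    obtain a b where "m = a + b" "a \<in> Poly_Mapping.keys p" "b \<in> Poly_Mapping.keys q"
      using m keys_mult[of p q] by blast
    then show ?thesis
      using p q Poly_Mapping.keys_add[of a b] unfolding poly_ring_def by blast
  qed
  ultimately show ?thesis
    by (simp add: poly_ring_def)
qed

lemma poly_ring_add: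
  assumes K: "real_subfield K" and p: "p \<in> poly_ring K X" and q: "q \<in> poly_ring K X"
  shows "p + q \<in> poly_ring K X"
  using assms Poly_Mapping.keys_add[of p q]
  by (fastforce simp: poly_ring_def real_subfield_def lookup_add)

lemma poly_ring_uminus:
  assumes "real_subfield K" "p \<in> poly_ring K X"
  shows "- p \<in> poly_ring K X"
  using assms by (auto simp: poly_ring_def real_subfield_def)

lemma poly_ring_mconst:
  assumes "real_subfield K" "a \<in> K"
  shows "mconst a \<in> poly_ring K X"
  using assms by (auto simp: poly_ring_def mconst_def lookup_single when_def real_subfield_def)

lemma poly_ring_mvar:
  assumes "real_subfield K" "v \<in> X"
  shows "mvar v \<in> poly_ring K X"
  using assms by (auto simp: poly_ring_def mvar_def lookup_single when_def real_subfield_def)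

text \<open>The embedding of constants is a ring homomorphism, so identities between real
  coefficients carry over to polynomials.\<close>

lemma mconst_simps:
  "mconst 0 = 0" "mconst 1 = 1" "mconst (of_nat n) = of_nat n" "mconst (a + b) = mconst a + mconst b"
  "mconst (- a) = - mconst a" "mconst (a * b) = mconst a * mconst b"
  by (simp_all add: mconst_def single_add mult_single single_uminus)

lemma mconst_sum: "mconst (sum f A) = (\<Sum>i\<in>A. mconst (f i))"
  by (induction A rule: infinite_finite_induct) (simp_all add: mconst_simps)

lemma mconst_power: "mconst (a ^ n) = mconst a ^ n"
  by (induction n) (simp_all add: mconst_simps)

lemma subring_ideal_ideal_gen:
  assumes K: "real_subfield K"
  shows "subring_ideal (poly_ring K X) (ideal_gen (poly_ring K X) B)"
proof
  let ?R = "poly_ring K X"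
  show one: "1 \<in> ?R"
    using poly_ring_mconst[OF K, of 1] K by (simp add: mconst_simps real_subfield_def)
  have zero: "0 \<in> ?R"
    using poly_ring_mconst[OF K, of 0] K by (simp add: mconst_simps real_subfield_def)
  show "- a \<in> ?R" if "a \<in> ?R" for a
    using poly_ring_uminus[OF K that] .
  show "a + b \<in> ?R" "a * b \<in> ?R" if "a \<in> ?R" "b \<in> ?R" for a b
    using poly_ring_add[OF K that] poly_ring_mult[OF K that] .
  show "0 \<in> ideal_gen ?R B"
    unfolding ideal_gen_def by (rule CollectI, rule exI[of _ "{}"]) simp
  show "a + b \<in> ideal_gen ?R B" if a: "a \<in> ideal_gen ?R B" and b: "b \<in> ideal_gen ?R B" for a b
  proof -
    obtain S p where S: "a = (\<Sum>b\<in>S. p b * b)" "finite S" "S \<subseteq> B" "\<And>b. b \<in> S \<Longrightarrow> p b \<in> ?R"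
      using a unfolding ideal_gen_def by blast
    obtain T q where T: "b = (\<Sum>b\<in>T. q b * b)" "finite T" "T \<subseteq> B" "\<And>b. b \<in> T \<Longrightarrow> q b \<in> ?R"
      using b unfolding ideal_gen_def by blast
    \<comment> \<open>The two combinations may use different generators; extending both multiplier
      families by zero to \<open>S \<union> T\<close> allows adding them termwise.\<close>
    define r where "r b = (if b \<in> S then p b else 0) + (if b \<in> T then q b else 0)" for b
    have "a = (\<Sum>b\<in>S \<union> T. (if b \<in> S then p b else 0) * b)"
      unfolding S(1) by (rule sum.mono_neutral_cong_left) (use S T in auto)
    moreover have "b = (\<Sum>b\<in>S \<union> T. (if b \<in> T then q b else 0) * b)"
      unfolding T(1) by (rule sum.mono_neutral_cong_left) (use S T in auto)
    ultimately have "a + b = (\<Sum>b\<in>S \<union> T. r b * b)"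
      by (simp add: r_def distrib_right sum.distrib)
    moreover have "\<forall>b\<in>S \<union> T. r b \<in> ?R"
      using S T zero by (auto simp: r_def intro: poly_ring_add[OF K])
    ultimately show ?thesis
      unfolding ideal_gen_def using S T by (intro CollectI exI[of _ "S \<union> T"] exI[of _ r]) auto
  qed
  show "a * b \<in> ideal_gen ?R B" if a: "a \<in> ?R" and b: "b \<in> ideal_gen ?R B" for a b
  proof -
    obtain T q where T: "b = (\<Sum>b\<in>T. q b * b)" "finite T" "T \<subseteq> B" "\<And>b. b \<in> T \<Longrightarrow> q b \<in> ?R"
      using b unfolding ideal_gen_def by blast
    have "a * b = (\<Sum>b\<in>T. (a * q b) * b)"
      by (simp add: T(1) sum_distrib_left mult_ac)
    then show ?thesis
      unfolding ideal_gen_def using T poly_ring_mult[OF K a]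
      by (intro CollectI exI[of _ T] exI[of _ "\<lambda>b. a * q b"]) auto
  qed
qed

lemma generator_in_ideal_gen:
  assumes "b \<in> B" "1 \<in> R"
  shows "b \<in> ideal_gen R B"
  unfolding ideal_gen_def
  by (rule CollectI, rule exI[of _ "{b}"], rule exI[of _ "\<lambda>_. 1"]) (use assms in simp)

section \<open>Total degree of sums and products\<close>

lemma total_degree_le_iff:
  "total_degree p \<le> n \<longleftrightarrow> (\<forall>m\<in>Poly_Mapping.keys p. monom_degree m \<le> n)"
  by (simp add: total_degree_def)

lemma monom_degree_superset:
  assumes "finite A" "Poly_Mapping.keys m \<subseteq> A"
  shows "monom_degree m = sum (Poly_Mapping.lookup m) A"
  unfolding monom_degree_def
  by (rule sum.mono_neutral_left) (use assms in \<open>auto simp: in_keys_iff\<close>)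

lemma monom_degree_add: "monom_degree (a + b) = monom_degree a + monom_degree b"
proof -
  let ?A = "Poly_Mapping.keys a \<union> Poly_Mapping.keys b"
  have "monom_degree c = sum (Poly_Mapping.lookup c) ?A" if "Poly_Mapping.keys c \<subseteq> ?A" for c
    by (rule monom_degree_superset) (use that in auto)
  then show ?thesis
    using Poly_Mapping.keys_add[of a b] by (simp add: lookup_add sum.distrib)
qed

lemma total_degree_sum_le:
  "(\<And>i. i \<in> A \<Longrightarrow> total_degree (f i) \<le> n) \<Longrightarrow> total_degree (sum f A) \<le> n"
proof (induction A rule: infinite_finite_induct)
  case (insert a A)
  then show ?case
    using Poly_Mapping.keys_add[of "f a" "sum f A"] by (fastforce simp: total_degree_le_iff)
qed (simp_all add: total_degree_le_iff)

lemma total_degree_mult_le: "total_degree (p * q) \<le> total_degree p + total_degree q"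
  unfolding total_degree_le_iff
proof
  fix m assume "m \<in> Poly_Mapping.keys (p * q)"
  then obtain a b where "m = a + b" "a \<in> Poly_Mapping.keys p" "b \<in> Poly_Mapping.keys q"
    using keys_mult[of p q] by auto
  then show "monom_degree m \<le> total_degree p + total_degree q"
    using total_degree_le_iff[of p "total_degree p"] total_degree_le_iff[of q "total_degree q"]
    by (auto simp: monom_degree_add intro: add_mono)
qed

lemma total_degree_prod_le: "total_degree (prod f A) \<le> (\<Sum>i\<in>A. total_degree (f i))"
proof (induction A rule: infinite_finite_induct)
  case (insert a A)
  then show ?case
    using total_degree_mult_le[of "f a" "prod f A"] by simp
qed (simp_all add: total_degree_def monom_degree_def)

lemma total_degree_mvar: "total_degree (mvar v) \<le> 1"
  by (simp add: total_degree_le_iff mvar_def monom_degree_def)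

lemma total_degree_mconst: "total_degree (mconst a) = 0"
  by (simp add: total_degree_def mconst_def monom_degree_def)

section \<open>The Vizing ideal\<close>

lemma card_cross:
  assumes "finite VG" "finite VH" "g \<in> VG" "h \<in> VH"
  shows "finite (cross VG VH g h)" "card (cross VG VH g h) = card VG + card VH - 1"
proof -
  \<comment> \<open>Leaving \<open>h\<close> out of the second arm makes the arms disjoint, since
    they would otherwise share \<open>(g, h)\<close>; this is the \<open>- 1\<close> in the
    cardinality.\<close>
  have eq: "cross VG VH g h = (\<lambda>g'. (g', h)) ` VG \<union> Pair g ` (VH - {h})"
    using assms by (auto simp: cross_def)
  show "finite (cross VG VH g h)"
    using assms by (simp add: eq)
  have "card (cross VG VH g h) = card ((\<lambda>g'. (g', h)) ` VG) + card (Pair g ` (VH - {h}))"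
    unfolding eq by (rule card_Un_disjoint) (use assms in auto)
  also have "\<dots> = card VG + (card VH - 1)"
    using assms by (simp add: card_image inj_on_def)
  also have "\<dots> = card VG + card VH - 1"
    using assms card_gt_0_iff[of VH] by auto
  finally show "card (cross VG VH g h) = card VG + card VH - 1" .
qed

text \<open>Centre and two arms are separated to match the three factors of the domination generator
  at \<open>(g, h)\<close>.\<close>

lemma prod_cross:
  assumes "finite VG" "finite VH" "g \<in> VG" "h \<in> VH"
  shows "(\<Prod>(g', h')\<in>cross VG VH g h. f g' h')
    = f g h * (\<Prod>g'\<in>VG - {g}. f g' h) * (\<Prod>h'\<in>VH - {h}. f g h')"
proof -
  have eq: "cross VG VH g h = insert (g, h) ((\<lambda>g'. (g', h)) ` (VG - {g}) \<union> Pair g ` (VH - {h}))"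
    using assms by (auto simp: cross_def)
  have "(\<Prod>(g', h')\<in>cross VG VH g h. f g' h') = f g h *
      (\<Prod>(g', h')\<in>(\<lambda>g'. (g', h)) ` (VG - {g}) \<union> Pair g ` (VH - {h}). f g' h')"
    unfolding eq by (subst prod.insert) (use assms in auto)
  also have "\<dots> = f g h * ((\<Prod>(g', h')\<in>(\<lambda>g'. (g', h)) ` (VG - {g}). f g' h')
      * (\<Prod>(g', h')\<in>Pair g ` (VH - {h}). f g' h'))"
    by (subst prod.union_disjoint) (use assms in auto)
  also have "\<dots> = f g h * ((\<Prod>g'\<in>VG - {g}. f g' h) * (\<Prod>h'\<in>VH - {h}. f g h'))"
    by (simp add: prod.reindex inj_on_def)
  finally show ?thesis
    by (simp add: mult.assoc)
qed

lemma rho_eq_esym: "rho VG VH g h = esym (\<lambda>(g', h'). xv g' h') (cross VG VH g h)"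
  by (simp add: rho_def esym_def fun_eq_iff)

lemma total_degree_rho: "total_degree (rho VG VH g h i) \<le> i"
  unfolding rho_def
proof (rule total_degree_sum_le)
  fix S assume "S \<in> {S. S \<subseteq> cross VG VH g h \<and> card S = i}"
  moreover have "total_degree (\<Prod>(g', h')\<in>S. xv g' h') \<le> (\<Sum>p\<in>S. total_degree (case p of (g', h') \<Rightarrow> xv g' h'))"
    by (rule total_degree_prod_le)
  moreover have "\<dots> \<le> (\<Sum>p\<in>S. 1)"
    by (rule sum_mono) (use total_degree_mvar in \<open>auto simp: xv_def\<close>)
  ultimately show "total_degree (\<Prod>(g', h')\<in>S. xv g' h') \<le> i"
    by auto
qed

section \<open>Domination numbers and Vizing's inequality on the two classes\<close>

lemma domination_number_ge_1:
  assumes "finite V" "V \<noteq> {}"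
  shows "1 \<le> domination_number V E"
proof -
  have fin: "finite {D. dominating_set V E D}"
    by (rule finite_subset[of _ "Pow V"]) (use assms in \<open>auto simp: dominating_set_def\<close>)
  have "V \<in> {D. dominating_set V E D}"
    by (auto simp: dominating_set_def)
  moreover have "1 \<le> card D" if "dominating_set V E D" for D
    using that assms finite_subset[of D V] by (auto simp: dominating_set_def Suc_le_eq card_gt_0_iff)
  ultimately show ?thesis
    unfolding domination_number_def using fin by (subst Min_ge_iff) auto
qed

lemma domination_number_le_1:
  assumes "finite V" "E \<in> graph_class V v"
  shows "domination_number V E \<le> 1"
proof -
  have fin: "finite {D. dominating_set V E D}"
    by (rule finite_subset[of _ "Pow V"]) (use assms in \<open>auto simp: dominating_set_def\<close>)
  have "dominating_set V E {v}"
    using assms(2) by (simp add: graph_class_def minimum_dominating_set_def)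
  then have "card {v} \<in> card ` {D. dominating_set V E D}"
    by blast
  then show ?thesis
    unfolding domination_number_def using fin by (metis Min_le card_1_singleton_iff finite_imageI One_nat_def)
qed

text \<open>Both factors are at most 1, as a single vertex dominates each graph, while the box
  product has a nonempty vertex set and so needs at least one dominating vertex.\<close>

lemma vizing_holds_on_dominated:
  assumes "finite VG" "VG \<noteq> {}" "finite VH" "VH \<noteq> {}"
  shows "vizing_holds_on VG (graph_class VG g1) VH (graph_class VH h1)"
  unfolding vizing_holds_on_def
proof (intro ballI)
  fix EG EH assume "EG \<in> graph_class VG g1" "EH \<in> graph_class VH h1"
  then have "domination_number VG EG * domination_number VH EH \<le> 1 * 1"
    using assms by (intro mult_mono domination_number_le_1) auto
  also have "\<dots> \<le> domination_number (VG \<times> VH) (box_edges VG EG VH EH)"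
    using domination_number_ge_1[of "VG \<times> VH"] assms by simp
  finally show "domination_number VG EG * domination_number VH EH
      \<le> domination_number (VG \<times> VH) (box_edges VG EG VH EH)" .
qed

section \<open>Congruences modulo the Vizing ideal\<close>

locale vizing =
  fixes K :: "real set" and VG :: "'a set" and VH :: "'b set" and g1 :: 'a and h1 :: 'b
  assumes finG: "finite VG" and finH: "finite VH" and K: "real_subfield K"
begin

abbreviation R where "R \<equiv> viz_ring K VG VH"
abbreviation I where "I \<equiv> viz_ideal K VG VH g1 h1"

sublocale subring_ideal R I
  unfolding viz_ideal_def viz_ring_def by (rule subring_ideal_ideal_gen[OF K])

notation eqv (infix \<open>\<simeq>\<close> 50)

lemma generator_in_I: "p \<in> viz_gens VG VH g1 h1 \<Longrightarrow> p \<in> I"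
  unfolding viz_ideal_def using one_R by (intro generator_in_ideal_gen)

lemma mconst_R: "a \<in> K \<Longrightarrow> mconst a \<in> R"
  unfolding viz_ring_def by (rule poly_ring_mconst[OF K])

lemma xv_R: "g \<in> VG \<Longrightarrow> h \<in> VH \<Longrightarrow> xv g h \<in> R"
  unfolding viz_ring_def xv_def by (rule poly_ring_mvar[OF K]) (auto simp: viz_vars_def)

lemma eG_R: "g \<in> VG \<Longrightarrow> g' \<in> VG \<Longrightarrow> g \<noteq> g' \<Longrightarrow> eG g g' \<in> R"
  unfolding viz_ring_def eG_def by (rule poly_ring_mvar[OF K]) (auto simp: viz_vars_def)

lemma eH_R: "h \<in> VH \<Longrightarrow> h' \<in> VH \<Longrightarrow> h \<noteq> h' \<Longrightarrow> eH h h' \<in> R"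
  unfolding viz_ring_def eH_def by (rule poly_ring_mvar[OF K]) (auto simp: viz_vars_def)

lemma xv_idem:
  assumes "g \<in> VG" "h \<in> VH"
  shows "xv g h * xv g h \<simeq> xv g h"
proof -
  have "xv g h * (xv g h - 1) \<in> I"
    by (rule generator_in_I) (use assms in \<open>auto simp: viz_gens_def\<close>)
  then show ?thesis
    by (simp add: eqv_def algebra_simps)
qed

text \<open>The difference of the two sides is \<open>e * (x * x - x)\<close>, a multiple of an
  element of the ideal.\<close>

lemma absorb_edge:
  assumes "e \<in> R" "x \<in> R" "x * x \<simeq> x"
  shows "(1 - e * x) * (1 - x) \<simeq> 1 - x"
proof -
  have "e * (x * x - x) \<in> I"
    using assms by (intro mult_I) (simp_all add: eqv_def)
  then show ?thesis
    by (simp add: eqv_def algebra_simps)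
qed

text \<open>Multiplying the product by the domination generator at \<open>(g, h)\<close> reproduces
  it modulo the ideal, factor by factor, and also yields a multiple of the generator.\<close>

lemma prod_cross_in_I:
  assumes g: "g \<in> VG" and h: "h \<in> VH"
  shows "(\<Prod>(g', h')\<in>cross VG VH g h. 1 - xv g' h') \<simeq> 0"
proof -
  let ?G = "\<Prod>g'\<in>VG - {g}. 1 - eG g g' * xv g' h"
  let ?H = "\<Prod>h'\<in>VH - {h}. 1 - eH h h' * xv g h'"
  let ?G1 = "\<Prod>g'\<in>VG - {g}. 1 - xv g' h"
  let ?H1 = "\<Prod>h'\<in>VH - {h}. 1 - xv g h'"
  note R = mult_R prod_R diff_R one_R xv_R eG_R eH_R
  have "(1 - xv g h) * ?G * ?H \<in> I"
    by (rule generator_in_I, unfold viz_gens_def, rule UnI2) (use assms in blast)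
  then have gen: "(1 - xv g h) * ?G * ?H \<simeq> 0"
    by (simp add: eqv_def)
  \<comment> \<open>At the centre the generator has the factor \<open>1 - xv g h\<close> itself,
    which is absorption with \<open>e = 1\<close>.\<close>
  have "(1 - xv g h) * (1 - xv g h) \<simeq> 1 - xv g h"
    using absorb_edge[of 1 "xv g h"] assms by (simp add: R xv_idem)
  moreover have "(\<Prod>g'\<in>VG - {g}. (1 - eG g g' * xv g' h) * (1 - xv g' h)) \<simeq> ?G1"
    by (intro eqv_prod absorb_edge R xv_idem) (use assms in auto)
  moreover have "(\<Prod>h'\<in>VH - {h}. (1 - eH h h' * xv g h') * (1 - xv g h')) \<simeq> ?H1"
    by (intro eqv_prod absorb_edge R xv_idem) (use assms in auto)
  ultimately have "(1 - xv g h) * (1 - xv g h)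
      * (\<Prod>g'\<in>VG - {g}. (1 - eG g g' * xv g' h) * (1 - xv g' h))
      * (\<Prod>h'\<in>VH - {h}. (1 - eH h h' * xv g h') * (1 - xv g h'))
      \<simeq> (1 - xv g h) * ?G1 * ?H1"
    by (intro eqv_mult) (use assms in \<open>auto intro!: R\<close>)
  \<comment> \<open>Splitting the paired factors with \<open>prod.distrib\<close> regroups the left
    side into the generator times the product.\<close>
  then have "(1 - xv g h) * ?G1 * ?H1 \<simeq> (1 - xv g h) * ?G * ?H * ((1 - xv g h) * ?G1 * ?H1)"
    by (intro eqv_sym[of "_ * _ * (_ * _ * _)"]) (simp add: prod.distrib mult_ac)
  also have "\<dots> \<simeq> 0 * ((1 - xv g h) * ?G1 * ?H1)"
    by (intro eqv_mult gen eqv_refl zero_R) (use assms in \<open>auto intro!: R\<close>)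
  finally show ?thesis
    using prod_cross[OF finG finH g h, of "\<lambda>g' h'. 1 - xv g' h'"] by simp
qed

lemma viz_poly_eqv_sum_squares:
  fixes c :: "nat \<Rightarrow> nat \<Rightarrow> real"
  assumes g: "g \<in> VG" and h: "h \<in> VH"
    and d: "d = card VG + card VH - 1" and "0 < m"
    and cK: "\<And>w i. w \<in> {1..m} \<Longrightarrow> i \<in> {0..m} \<Longrightarrow> c w i \<in> K"
    and c0: "\<And>w. w \<in> {1..m} \<Longrightarrow> c w 0 = - c w 1"
    and eqs: "\<And>k. k \<in> {2..d} \<Longrightarrow>
      (- 1) ^ k * ((\<Sum>w=1..m. (c w 1)\<^sup>2) + 1) =
        (\<Sum>i=ceil_half k..min k m. \<Sum>w=1..m.
           (c w i)\<^sup>2 * real (i choose (k - i)) * real (k choose i))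
      + 2 * (\<Sum>j=ceil_half (k + 1)..min k m. \<Sum>i=k - j..j - 1. \<Sum>w=1..m.
           c w i * c w j * real (i choose (k - j)) * real (k choose i))"
  shows "viz_poly VG VH 1 1 \<simeq> (\<Sum>(g', h')\<in>VG \<times> VH - cross VG VH g h. (xv g' h')\<^sup>2)
    + (\<Sum>w=1..m. (\<Sum>i=0..m. mconst (c w i) * rho VG VH g h i)\<^sup>2)"
proof -
  define S where "S = (\<Sum>w=1..m. (c w 1)\<^sup>2)"
  have pos: "0 < card VG" "0 < card VH"
    using g h finG finH by (auto simp: card_gt_0_iff)
  let ?T = "cross VG VH g h"
  let ?x = "\<lambda>(g', h'). xv g' h'"
  let ?e = "esym ?x ?T"
  have finT: "finite ?T" and cardT: "card ?T = d"
    using card_cross[OF finG finH g h] d by auto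
  have TV: "?T \<subseteq> VG \<times> VH"
    by (auto simp: cross_def)
  have "0 < d"
    using d pos by simp
  have e1: "?e 1 = (\<Sum>p\<in>?T. ?x p)"
  proof -
    have "{A. A \<subseteq> ?T \<and> card A = 1} = (\<lambda>p. {p}) ` ?T"
      by (auto simp: card_1_singleton_iff)
    then show ?thesis
      by (simp add: esym_def sum.reindex)
  qed
  have e0: "?e 0 = 1"
  proof -
    \<comment> \<open>Finiteness of the cross enters because \<open>card\<close> is also 0 on
      infinite sets.\<close>
    have "{A. A \<subseteq> ?T \<and> card A = 0} = {{}}"
      using finite_subset[OF _ finT] by (auto simp: card_eq_0_iff)
    then show ?thesis
      by (simp add: esym_def)
  qed
  \<comment> \<open>All summands are constant polynomials, so the real identity
    \<open>coefficient_eqs\<close> can be applied under \<open>mconst\<close>.\<close>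
  have coeff: "(\<Sum>w=1..m. \<Sum>i=0..m. \<Sum>j=0..m.
        mconst (c w i) * mconst (c w j) * of_nat (cover_count k i j))
      = mconst (S + 1) * (- 1) ^ k + (if k = 0 then - 1 else if k = 1 then 1 else 0)"
    if "k \<le> d" for k
  proof -
    have "(\<Sum>w=1..m. \<Sum>i=0..m. \<Sum>j=0..m.
        mconst (c w i) * mconst (c w j) * of_nat (cover_count k i j))
      = mconst (\<Sum>w=1..m. \<Sum>i=0..m. \<Sum>j=0..m. c w i * c w j * real (cover_count k i j))"
      by (simp add: mconst_sum mconst_simps)
    also have "\<dots> = mconst ((- 1) ^ k * (S + 1) + (if k = 0 then - 1 else if k = 1 then 1 else 0))"
      unfolding S_def
      by (subst coefficient_eqs[where d = d]) (use c0 eqs that \<open>0 < m\<close> in auto)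
    also have "\<dots> = mconst (S + 1) * (- 1) ^ k + (if k = 0 then - 1 else if k = 1 then 1 else 0)"
      by (simp add: mconst_simps mconst_power algebra_simps)
    finally show ?thesis .
  qed
  have "(\<Sum>w=1..m. (\<Sum>i=0..m. mconst (c w i) * ?e i)\<^sup>2)
    \<simeq> (\<Sum>k\<le>d. (\<Sum>w=1..m. \<Sum>i=0..m. \<Sum>j=0..m.
        mconst (c w i) * mconst (c w j) * of_nat (cover_count k i j)) * ?e k)"
    unfolding cardT[symmetric]
    by (rule sum_squares_esym_eqv) (use finT TV cK in \<open>auto intro!: xv_R xv_idem mconst_R\<close>)
  also have "\<dots> = (\<Sum>k\<le>d. mconst (S + 1) * ((- 1) ^ k * ?e k)
      + (if k = 0 then - 1 else if k = 1 then ?e 1 else 0))"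
    by (rule sum.cong[OF refl], subst coeff) (auto simp: e0 algebra_simps)
  also have "\<dots> = mconst (S + 1) * (\<Sum>k\<le>d. (- 1) ^ k * ?e k)
      + (\<Sum>k\<le>d. if k = 0 then - 1 else if k = 1 then ?e 1 else 0)"
    by (simp add: sum.distrib sum_distrib_left)
  \<comment> \<open>The corrections live at \<open>k = 0\<close> and \<open>k = 1\<close>; both
    indices are in range because \<open>0 < d\<close>.\<close>
  also have "(\<Sum>k\<le>d. if k = 0 then - 1 else if k = 1 then ?e 1 else 0)
      = (\<Sum>k\<in>{0, 1::nat}. if k = 0 then - 1 else if k = 1 then ?e 1 else 0)"
    by (rule sum.mono_neutral_right) (use \<open>0 < d\<close> in auto)
  also have "mconst (S + 1) * (\<Sum>k\<le>d. (- 1) ^ k * ?e k)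
        + (\<Sum>k\<in>{0, 1::nat}. if k = 0 then - 1 else if k = 1 then ?e 1 else 0)
      \<simeq> mconst (S + 1) * 0 + (\<Sum>k\<in>{0, 1::nat}. if k = 0 then - 1 else if k = 1 then ?e 1 else 0)"
  proof (intro eqv_add eqv_mult eqv_refl)
    \<comment> \<open>The alternating sum is multiplied by the constant \<open>S + 1\<close>, which
      has to be a legitimate multiplier over \<open>K\<close>.\<close>
    have "S \<in> K"
      unfolding S_def using cK \<open>0 < m\<close> K
      by (intro real_subfield_sum[OF K]) (auto simp: power2_eq_square real_subfield_def)
    then show "mconst (S + 1) \<in> R"
      using K by (intro mconst_R) (auto simp: real_subfield_def)
    show "(\<Sum>k\<le>d. (- 1) ^ k * ?e k) \<simeq> 0"
      using prod_cross_in_I[OF g h] prod_one_minus_eq_esym[OF finT, of ?x]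
      by (simp add: cardT case_prod_unfold)
    show "(\<Sum>k\<le>d. (- 1) ^ k * ?e k) \<in> R"
      unfolding cardT[symmetric] prod_one_minus_eq_esym[OF finT, symmetric]
        using TV by (auto intro!: prod_R diff_R one_R xv_R)
  qed
  finally have squares: "(\<Sum>w=1..m. (\<Sum>i=0..m. mconst (c w i) * ?e i)\<^sup>2) \<simeq> (\<Sum>p\<in>?T. ?x p) - 1"
    by (simp add: e1 del: One_nat_def)
  \<comment> \<open>Off the cross each square reduces to its variable; together with the cross
    variables minus 1 from \<open>squares\<close> this is the Vizing polynomial.\<close>
  have "(\<Sum>p\<in>VG \<times> VH - ?T. (?x p)\<^sup>2) \<simeq> (\<Sum>p\<in>VG \<times> VH - ?T. ?x p)"
    by (intro eqv_sum) (auto simp: power2_eq_square intro: xv_idem)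
  from eqv_add[OF this squares]
  have "(\<Sum>p\<in>VG \<times> VH - ?T. (?x p)\<^sup>2) + (\<Sum>w=1..m. (\<Sum>i=0..m. mconst (c w i) * ?e i)\<^sup>2)
      \<simeq> viz_poly VG VH 1 1"
    using sum.subset_diff[OF TV, of ?x] finG finH
    by (simp add: viz_poly_def algebra_simps)
  from eqv_sym[OF this] show ?thesis
    unfolding rho_eq_esym by (simp add: case_prod_unfold)
qed

end

theorem theorem5p1:
  fixes K :: "real set" and VG :: "'a set" and VH :: "'b set" and g1 :: 'a and h1 :: 'b
    and c :: "nat \<Rightarrow> nat \<Rightarrow> real" and d m :: nat
  assumes "finite VG" and "g1 \<in> VG" and "finite VH" and "h1 \<in> VH"
    and d: "d = card VG + card VH - 1"
    and m: "m = ceil_half d"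
    and "real_subfield K"
    and "\<forall>w\<in>{1..m}. \<forall>i\<in>{0..m}. c w i \<in> K"
    and "\<forall>w\<in>{1..m}. c w 0 = - c w 1"
    and "\<forall>k\<in>{2..d}.
      (- 1) ^ k * ((\<Sum>w=1..m. (c w 1)\<^sup>2) + 1) =
        (\<Sum>i=ceil_half k..min k m. \<Sum>w=1..m.
           (c w i)\<^sup>2 * real (i choose (k - i)) * real (k choose i))
      + 2 * (\<Sum>j=ceil_half (k + 1)..min k m. \<Sum>i=k - j..j - 1. \<Sum>w=1..m.
           c w i * c w j * real (i choose (k - j)) * real (k choose i))"
  shows "(\<forall>g\<in>VG. \<forall>h\<in>VH.
      sos_certificate m (viz_ring K VG VH) (viz_ideal K VG VH g1 h1) (viz_poly VG VH 1 1)
        ((VG \<times> VH - cross VG VH g h) <+> {1..m})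
        (case_sum (\<lambda>(g', h'). xv g' h') (\<lambda>w. \<Sum>i=0..m. mconst (c w i) * rho VG VH g h i))
    \<and> viz_poly VG VH 1 1
        - ((\<Sum>(g', h')\<in>VG \<times> VH - cross VG VH g h. (xv g' h')\<^sup>2)
           + (\<Sum>w=1..m. (\<Sum>i=0..m. mconst (c w i) * rho VG VH g h i)\<^sup>2))
        \<in> viz_ideal K VG VH g1 h1)
    \<and> vizing_holds_on VG (graph_class VG g1) VH (graph_class VH h1)"
proof -
  interpret vizing K VG VH g1 h1
    by unfold_locales fact+
  have pos: "0 < card VG" "0 < card VH"
    using assms(1-4) by (auto simp: card_gt_0_iff)
  then have "0 < m"
    unfolding m d ceil_half_eq by simp
  have viz: "viz_poly VG VH 1 1
        - ((\<Sum>(g', h')\<in>VG \<times> VH - cross VG VH g h. (xv g' h')\<^sup>2)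
           + (\<Sum>w=1..m. (\<Sum>i=0..m. mconst (c w i) * rho VG VH g h i)\<^sup>2))
        \<in> viz_ideal K VG VH g1 h1" if g: "g \<in> VG" and h: "h \<in> VH" for g h
  proof -
    have "\<And>w i. w \<in> {1..m} \<Longrightarrow> i \<in> {0..m} \<Longrightarrow> c w i \<in> K" "\<And>w. w \<in> {1..m} \<Longrightarrow> c w 0 = - c w 1"
      using assms(8,9) by auto
    from viz_poly_eqv_sum_squares[OF g h d \<open>0 < m\<close> this assms(10)[rule_format]]
    show ?thesis
      unfolding eqv_def .
  qed
  have "sos_certificate m (viz_ring K VG VH) (viz_ideal K VG VH g1 h1) (viz_poly VG VH 1 1)
        ((VG \<times> VH - cross VG VH g h) <+> {1..m})
        (case_sum (\<lambda>(g', h'). xv g' h') (\<lambda>w. \<Sum>i=0..m. mconst (c w i) * rho VG VH g h i))"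
    if g: "g \<in> VG" and h: "h \<in> VH" for g h
    unfolding sos_certificate_def
  proof (intro conjI ballI)
    let ?J = "(VG \<times> VH - cross VG VH g h) <+> {1..m}"
    let ?s = "case_sum (\<lambda>(g', h'). xv g' h') (\<lambda>w. \<Sum>i=0..m. mconst (c w i) * rho VG VH g h i)"
    show "finite ?J"
      using \<open>finite VG\<close> \<open>finite VH\<close> by simp
    \<comment> \<open>The disjoint sum \<open><+>\<close> indexes both kinds of squares by one set,
      so the sum over it splits into the two sums of \<open>viz\<close>.\<close>
    have "(\<Sum>j\<in>?J. (?s j)\<^sup>2) = (\<Sum>(g', h')\<in>VG \<times> VH - cross VG VH g h. (xv g' h')\<^sup>2)
           + (\<Sum>w=1..m. (\<Sum>i=0..m. mconst (c w i) * rho VG VH g h i)\<^sup>2)"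
      using \<open>finite VG\<close> \<open>finite VH\<close> by (subst sum.Plus) (auto simp: case_prod_unfold)
    then show "viz_poly VG VH 1 1 - (\<Sum>j\<in>?J. (?s j)\<^sup>2) \<in> I"
      using viz[OF g h] by simp
    fix j assume j: "j \<in> ?J"
    have "rho VG VH g h i \<in> R" for i
      unfolding rho_eq_esym by (rule esym_R) (auto simp: cross_def intro: xv_R)
    then show "?s j \<in> R"
      using j assms(8) by (auto intro!: xv_R sum_R mult_R mconst_R)
    have "total_degree (mconst (c w i) * rho VG VH g h i) \<le> m" if "i \<le> m" for w i
      using total_degree_mult_le[of "mconst (c w i)" "rho VG VH g h i"]
        total_degree_rho[of VG VH g h i] that by (simp add: total_degree_mconst)
    \<comment> \<open>A single variable has degree 1, which fits the bound because
      \<open>0 < m\<close>.\<close>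
    moreover have "total_degree (xv g' h') \<le> m" for g' h'
      using total_degree_mvar[of "Vert g' h'"] \<open>0 < m\<close> by (simp add: xv_def)
    ultimately show "total_degree (?s j) \<le> m"
      using j by (auto intro!: total_degree_sum_le)
  qed
  moreover have "vizing_holds_on VG (graph_class VG g1) VH (graph_class VH h1)"
    by (rule vizing_holds_on_dominated) (use assms(1-4) in auto)
  ultimately show ?thesis
    using viz by blast
qed

end
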